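(* $\mathrm{two}_+\geq\frac{5}{2}$; that is, there is no online coloring algorithm for 2-count interval graphs with competitive ratio less than $\frac{5}{2}$ in the setting where the two interval lengths are known in advance but the interval representation is unknown.
   Context: A 2-count interval graph is a graph having an interval representation (an assignment of closed real intervals to vertices such that two vertices are adjacent iff their intervals intersect) in which at most two distinct interval lengths occur. In the setting $\mathrm{two}_+$, before the first vertex is presented the algorithm is told two lengths (which may depend on the clique number of the graph to be presented) such that the presented graph has an interval representation using only those lengths; the vertices are then presented one at a time, the algorithm learning only adjacencies to previously presented vertices (not intervals), and it must irrevocably assign each vertex a color different from those of its earlier neighbours. For an online algorithm $A$, $\chi_A(G)$ denotes the maximum number of colors $A$ uses on $G$ over all presentations; $A$ is $\rho$-competitive if there is $b\in\mathbb{R}$ with $\chi_A(G)\le\rho\chi(G)+b$ for all graphs $G$ in the class; the competitive ratio of $A$ is the infimum of such $\rho$, and $\mathrm{two}_+$ is the infimum of the competitive ratios over all online algorithms in this setting. *)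

theory Defs
  imports "HOL-Library.Extended_Real"
begin

text \<open>Labelling the vertices by natural numbers loses no generality: the graphs are finite and an
  online algorithm (below) never sees the labels.\<close>

type_synonym graph = "nat set \<times> nat set set"

abbreviation verts :: "graph \<Rightarrow> nat set" where "verts \<equiv> fst"
abbreviation edges :: "graph \<Rightarrow> nat set set" where "edges \<equiv> snd"

definition simple_graph :: "graph \<Rightarrow> bool" where
  "simple_graph G \<longleftrightarrow> finite (verts G) \<and> (\<forall>e \<in> edges G. e \<subseteq> verts G \<and> card e = 2)"

definition proper_coloring :: "graph \<Rightarrow> (nat \<Rightarrow> nat) \<Rightarrow> bool" where
  "proper_coloring G c \<longleftrightarrow> (\<forall>u \<in> verts G. \<forall>v \<in> verts G. {u, v} \<in> edges G \<longrightarrow> c u \<noteq> c v)"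

definition chromatic_number :: "graph \<Rightarrow> nat" where
  "chromatic_number G = (LEAST k. \<exists>c. proper_coloring G c \<and> card (c ` verts G) = k)"

text \<open>Vertex \<open>v\<close> is represented by the closed interval \<open>{l v..r v}\<close>. Intervals are
  non-degenerate, so all lengths are positive. As the graphs are finite, admitting single points
  would not enlarge the class of representable graphs.\<close>

definition interval_rep :: "graph \<Rightarrow> (nat \<Rightarrow> real) \<Rightarrow> (nat \<Rightarrow> real) \<Rightarrow> bool" where
  "interval_rep G l r \<longleftrightarrow>
     (\<forall>v \<in> verts G. l v < r v) \<and>
     (\<forall>u \<in> verts G. \<forall>v \<in> verts G. u \<noteq> v \<longrightarrow>
        ({u, v} \<in> edges G \<longleftrightarrow> {l u..r u} \<inter> {l v..r v} \<noteq> {}))"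

definition rep_lengths :: "graph \<Rightarrow> (nat \<Rightarrow> real) \<Rightarrow> (nat \<Rightarrow> real) \<Rightarrow> real set" where
  "rep_lengths G l r = (\<lambda>v. r v - l v) ` verts G"

definition two_count_interval_graph :: "graph \<Rightarrow> bool" where
  "two_count_interval_graph G \<longleftrightarrow>
     simple_graph G \<and> (\<exists>l r. interval_rep G l r \<and> card (rep_lengths G l r) \<le> 2)"

text \<open>The lengths \<open>a < b\<close> may be announced for \<open>G\<close>. They may be chosen freely for each graph (in
  particular, in dependence on its clique number), and one of them may remain unused.\<close>

definition admissible_lengths :: "graph \<Rightarrow> real \<Rightarrow> real \<Rightarrow> bool" where
  "admissible_lengths G a b \<longleftrightarrow>
     0 < a \<and> a < b \<and> (\<exists>l r. interval_rep G l r \<and> rep_lengths G l r \<subseteq> {a, b})"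

text \<open>A presentation of \<open>G\<close> consists of the two announced lengths and an ordering of the
  vertices.\<close>

definition presentation :: "graph \<Rightarrow> real \<Rightarrow> real \<Rightarrow> nat list \<Rightarrow> bool" where
  "presentation G a b vs \<longleftrightarrow> admissible_lengths G a b \<and> distinct vs \<and> set vs = verts G"

text \<open>What has been revealed once the vertex at position \<open>i\<close> is presented: for every position
  \<open>k \<le> i\<close>, the set of the earlier positions whose vertices are adjacent to the \<open>k\<close>-th one.\<close>

definition history :: "graph \<Rightarrow> nat list \<Rightarrow> nat \<Rightarrow> nat set list" where
  "history G vs i = map (\<lambda>k. {j. j < k \<and> {vs ! j, vs ! k} \<in> edges G}) [0..<Suc i]"

text \<open>A (deterministic) algorithm maps the two announced lengths and the current history to the
  color of the newest vertex. The earlier colors are determined by the prefixes of the history, so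
  they need not be passed as arguments.\<close>

type_synonym algorithm = "real \<Rightarrow> real \<Rightarrow> nat set list \<Rightarrow> nat"

definition color_at :: "algorithm \<Rightarrow> graph \<Rightarrow> real \<Rightarrow> real \<Rightarrow> nat list \<Rightarrow> nat \<Rightarrow> nat" where
  "color_at A G a b vs i = A a b (history G vs i)"

definition online_algorithm :: "algorithm \<Rightarrow> bool" where
  "online_algorithm A \<longleftrightarrow>
     (\<forall>G a b vs. two_count_interval_graph G \<longrightarrow> presentation G a b vs \<longrightarrow>
        (\<forall>j < length vs. \<forall>i < j. {vs ! i, vs ! j} \<in> edges G \<longrightarrow>
           color_at A G a b vs i \<noteq> color_at A G a b vs j))"

definition colors_used :: "algorithm \<Rightarrow> graph \<Rightarrow> real \<Rightarrow> real \<Rightarrow> nat list \<Rightarrow> nat" where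
  "colors_used A G a b vs = card (color_at A G a b vs ` {..<length vs})"

definition online_chi :: "algorithm \<Rightarrow> graph \<Rightarrow> nat" where
  "online_chi A G = Max {colors_used A G a b vs | a b vs. presentation G a b vs}"

definition competitive :: "real \<Rightarrow> algorithm \<Rightarrow> bool" where
  "competitive \<rho> A \<longleftrightarrow>
     (\<exists>b::real. \<forall>G. two_count_interval_graph G \<longrightarrow>
        real (online_chi A G) \<le> \<rho> * real (chromatic_number G) + b)"

text \<open>Infima are taken in the extended reals: the ratio is \<open>\<infinity>\<close> if the algorithm is not
  \<open>\<rho>\<close>-competitive for any \<open>\<rho>\<close>.\<close>

definition competitive_ratio :: "algorithm \<Rightarrow> ereal" where
  "competitive_ratio A = (INF \<rho> \<in> {\<rho>. competitive \<rho> A}. ereal \<rho>)"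

definition two_plus :: ereal where
  "two_plus = (INF A \<in> {A. online_algorithm A}. competitive_ratio A)"

text \<open>The maximum in \<open>online_chi\<close> is over a finite nonempty set.\<close>

lemma finite_colors_used:
  assumes "simple_graph G"
  shows "finite {colors_used A G a b vs | a b vs. presentation G a b vs}"
proof (rule finite_subset)
  show "{colors_used A G a b vs | a b vs. presentation G a b vs} \<subseteq> {..card (verts G)}"
  proof clarsimp
    fix a b vs assume "presentation G a b vs"
    then have "length vs = card (verts G)"
      using distinct_card by (fastforce simp: presentation_def)
    then show "colors_used A G a b vs \<le> card (verts G)"
      using card_image_le[of "{..<length vs}" "color_at A G a b vs"] by (simp add: colors_used_def)
  qed
qed simp

lemma exists_two_lengths:
  fixes L :: "real set"
  assumes "finite L" "card L \<le> 2" "\<forall>x \<in> L. 0 < x"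
  shows "\<exists>a b. 0 < a \<and> a < b \<and> L \<subseteq> {a, b}"
proof -
  consider "card L = 0" | "card L = 1" | "card L = 2" using assms(2) by linarith
  then show ?thesis
  proof cases
    case 1
    then have "L = {}" using assms(1) by simp
    then show ?thesis by (intro exI[of _ 1] exI[of _ 2]) simp
  next
    case 2
    then obtain x where "L = {x}" by (auto simp: card_1_singleton_iff)
    with assms(3) show ?thesis by (intro exI[of _ x] exI[of _ "x + 1"]) simp
  next
    case 3
    then obtain x y where "L = {x, y}" "x \<noteq> y" by (auto simp: card_2_iff)
    with assms(3) show ?thesis
      by (intro exI[of _ "min x y"] exI[of _ "max x y"]) (auto simp: min_def max_def)
  qed
qed

lemma exists_presentation:
  assumes "two_count_interval_graph G"
  shows "\<exists>a b vs. presentation G a b vs"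
proof -
  have fin: "finite (verts G)"
    using assms by (simp add: two_count_interval_graph_def simple_graph_def)
  obtain l r where rep: "interval_rep G l r" and len: "card (rep_lengths G l r) \<le> 2"
    using assms by (auto simp: two_count_interval_graph_def)
  have "finite (rep_lengths G l r)" "\<forall>x \<in> rep_lengths G l r. 0 < x"
    using fin rep by (auto simp: rep_lengths_def interval_rep_def)
  then obtain a b where "0 < a" "a < b" "rep_lengths G l r \<subseteq> {a, b}"
    using exists_two_lengths len by metis
  with rep have "admissible_lengths G a b" by (auto simp: admissible_lengths_def)
  moreover obtain vs where "set vs = verts G" "distinct vs"
    using finite_distinct_list[OF fin] by blast
  ultimately show ?thesis by (auto simp: presentation_def)
qed

end

theory Submission
  imports Defs
begin

text \<open>One fixed graph with \<open>\<chi> \<le> 2 p\<close> is presented; the adversary chooses nothing but the order of its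
  vertices. Whenever the revealed induced subgraph has an automorphism, the vertices already
  presented may be renamed along it, so by the pigeonhole principle finitely many disjoint copies
  of a structure can be assumed to have received the same set of colors.

  Two disjoint cliques \<open>l\<^sub>j\<close> and \<open>r\<^sub>j\<close> (\<open>j < n = p - 1\<close>) of short intervals with identical colors are
  joined by a clique \<open>q\<^sub>i\<close>, where \<open>q\<^sub>i\<close> meets \<open>l\<^sub>j\<close> for \<open>j \<ge> i\<close> and \<open>r\<^sub>j\<close> for \<open>j \<le> i\<close>. Each \<open>q\<^sub>i\<close> sees
  all \<open>n\<close> colors, so this gadget has \<open>2 n\<close> colors although its clique number is only \<open>n + 1\<close>.
  Next, cliques of \<open>p\<close> long intervals cover gadgets that all carry the same \<open>2 n\<close> colors. Two such
  covers with equal colors become the ends of a path of four covers; the two middle ones need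
  \<open>2 p\<close> further colors. This makes \<open>2 n + 3 p = 5 p - 2\<close> colors in total.\<close>

section \<open>Adaptive presentations\<close>

text \<open>This is \<open>color_at\<close> over an arbitrary vertex type and adjacency predicate,
  so that the adversary can work with structured vertices.\<close>

definition play_color ::
  "algorithm \<Rightarrow> real \<Rightarrow> real \<Rightarrow> ('v \<Rightarrow> 'v \<Rightarrow> bool) \<Rightarrow> 'v list \<Rightarrow> nat \<Rightarrow> nat" where
  "play_color A a b adj us i = A a b (map (\<lambda>k. {j. j < k \<and> adj (us ! j) (us ! k)}) [0..<Suc i])"

lemma play_color_cong:
  assumes "\<And>j k. j < k \<Longrightarrow> k \<le> i \<Longrightarrow> adj (us ! j) (us ! k) \<longleftrightarrow> adj' (us' ! j) (us' ! k)"
  shows "play_color A a b adj us i = play_color A a b adj' us' i"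
proof -
  have "map (\<lambda>k. {j. j < k \<and> adj (us ! j) (us ! k)}) [0..<Suc i] =
        map (\<lambda>k. {j. j < k \<and> adj' (us' ! j) (us' ! k)}) [0..<Suc i]"
    using assms by (intro map_cong refl Collect_cong) auto
  then show ?thesis
    by (simp only: play_color_def)
qed

text \<open>The order is hidden: later arguments only need that some order of \<open>V\<close> makes
  the algorithm produce \<open>c\<close>. Outside \<open>V\<close>, \<open>c\<close> is
  unconstrained.\<close>

definition reachable ::
  "algorithm \<Rightarrow> real \<Rightarrow> real \<Rightarrow> ('v \<Rightarrow> 'v \<Rightarrow> bool) \<Rightarrow> 'v set \<Rightarrow> ('v \<Rightarrow> nat) \<Rightarrow> bool" where
  "reachable A a b adj V c \<longleftrightarrow>
     (\<exists>us. distinct us \<and> set us = V \<and> (\<forall>i < length us. c (us ! i) = play_color A a b adj us i))"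

lemma reachable_empty: "reachable A a b adj {} c"
  unfolding reachable_def by (intro exI[of _ "[]"]) simp

text \<open>New vertices are appended to the order. A color depends only on the prefix up to its
  position, so the old colors persist.\<close>

lemma reachable_extend:
  assumes "reachable A a b adj V c" "finite V'" "V \<inter> V' = {}"
  obtains c' where "reachable A a b adj (V \<union> V') c'" "\<And>v. v \<in> V \<Longrightarrow> c' v = c v"
proof -
  obtain us where us: "distinct us" "set us = V"
      "\<And>i. i < length us \<Longrightarrow> c (us ! i) = play_color A a b adj us i"
    using assms(1) unfolding reachable_def by blast
  obtain ws where ws: "distinct ws" "set ws = V'"
    using finite_distinct_list[OF assms(2)] by blast
  define ts where "ts = us @ ws"
  have dist: "distinct ts"
    using us ws assms(3) by (simp add: ts_def)
  define c' where "c' v = play_color A a b adj ts (THE i. i < length ts \<and> ts ! i = v)" for v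
  have c': "c' (ts ! i) = play_color A a b adj ts i" if "i < length ts" for i
  proof -
    have "(THE k. k < length ts \<and> ts ! k = ts ! i) = i"
      using that dist by (intro the_equality) (auto simp: nth_eq_iff_index_eq)
    then show ?thesis by (simp add: c'_def)
  qed
  have "c' v = c v" if "v \<in> V" for v
  proof -
    have "v \<in> set us" using that us(2) by simp
    then obtain i where i: "i < length us" "v = us ! i"
      unfolding in_set_conv_nth by blast
    have "play_color A a b adj ts i = play_color A a b adj us i"
      using i by (intro play_color_cong) (auto simp: ts_def nth_append)
    with i c'[of i] us(3)[of i] show ?thesis
      by (simp add: ts_def nth_append)
  qed
  moreover have "reachable A a b adj (V \<union> V') c'"
    unfolding reachable_def using dist c' us ws by (intro exI[of _ ts]) (auto simp: ts_def)
  ultimately show thesis by (rule that[rotated])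
qed

text \<open>Presenting in place of each vertex its preimage under \<open>\<phi>\<close> leaves every
  history unchanged, so \<open>v\<close> receives the color that \<open>\<phi> v\<close> had. Thus
  the adversary may decide afterwards which vertices were presented.\<close>

lemma reachable_automorphism:
  assumes "reachable A a b adj V c" and bij: "bij_betw \<phi> V V"
    and adj: "\<And>u v. u \<in> V \<Longrightarrow> v \<in> V \<Longrightarrow> adj (\<phi> u) (\<phi> v) \<longleftrightarrow> adj u v"
  shows "reachable A a b adj V (c \<circ> \<phi>)"
proof -
  obtain us where us: "distinct us" "set us = V"
      "\<And>i. i < length us \<Longrightarrow> c (us ! i) = play_color A a b adj us i"
    using assms(1) unfolding reachable_def by blast
  define \<psi> where "\<psi> = inv_into V \<phi>"
  have bij': "bij_betw \<psi> V V"
    unfolding \<psi>_def by (rule bij_betw_inv_into[OF bij])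
  have inv: "\<phi> (\<psi> v) = v" if "v \<in> V" for v
    using that bij unfolding \<psi>_def by (simp add: bij_betw_inv_into_right)
  have mem: "us ! i \<in> V" if "i < length us" for i
    using that us(2) by auto
  have "play_color A a b adj (map \<psi> us) i = play_color A a b adj us i" if "i < length us" for i
  proof (rule play_color_cong)
    fix j k assume "j < k" "k \<le> i"
    then have "us ! j \<in> V" "us ! k \<in> V" "j < length us" "k < length us"
      using that mem by auto
    then show "adj (map \<psi> us ! j) (map \<psi> us ! k) \<longleftrightarrow> adj (us ! j) (us ! k)"
      using adj[of "\<psi> (us ! j)" "\<psi> (us ! k)"] inv bij_betwE[OF bij'] by simp
  qed
  then have "\<forall>i < length (map \<psi> us). (c \<circ> \<phi>) (map \<psi> us ! i) = play_color A a b adj (map \<psi> us) i"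
    using us(3) inv mem by simp
  moreover have "distinct (map \<psi> us)" "set (map \<psi> us) = V"
    using us bij' by (auto simp: distinct_map bij_betw_def)
  ultimately show ?thesis
    unfolding reachable_def by blast
qed

section \<open>From abstract play to presentations of a finite graph\<close>

lemma colors_used_le_online_chi:
  assumes "simple_graph G" "presentation G a b vs"
  shows "colors_used A G a b vs \<le> online_chi A G"
  unfolding online_chi_def using assms by (intro Max_ge finite_colors_used) blast+

lemma chromatic_number_le:
  assumes "proper_coloring G c" "c ` verts G \<subseteq> {..<k}"
  shows "chromatic_number G \<le> k"
proof -
  have "chromatic_number G \<le> card (c ` verts G)"
    unfolding chromatic_number_def using assms(1) by (intro Least_le) blast
  also have "\<dots> \<le> k"
    using card_mono[OF _ assms(2)] by simp
  finally show ?thesis .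
qed

text \<open>The coloring \<open>h\<close> witnesses \<open>\<chi> \<le> k\<close>, and \<open>m\<close> bounds the number of colors of the algorithm on
  such graphs.\<close>

locale two_length_game =
  fixes A :: algorithm and a b :: real and adj :: "'v \<Rightarrow> 'v \<Rightarrow> bool"
    and U :: "'v set" and l r :: "'v \<Rightarrow> real" and h :: "'v \<Rightarrow> nat" and k m :: nat
  assumes online: "online_algorithm A"
    and lengths: "0 < a" "a < b"
    and len: "v \<in> U \<Longrightarrow> r v - l v \<in> {a, b}"
    and adj_iff: "u \<in> U \<Longrightarrow> v \<in> U \<Longrightarrow> adj u v \<longleftrightarrow> u \<noteq> v \<and> l u \<le> r v \<and> l v \<le> r u"
    and h_proper: "u \<in> U \<Longrightarrow> v \<in> U \<Longrightarrow> adj u v \<Longrightarrow> h u \<noteq> h v"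
    and h_less: "v \<in> U \<Longrightarrow> h v < k"
    and bound: "two_count_interval_graph G \<Longrightarrow> chromatic_number G \<le> k \<Longrightarrow> online_chi A G \<le> m"
begin

abbreviation reach :: "'v set \<Rightarrow> ('v \<Rightarrow> nat) \<Rightarrow> bool" where
  "reach \<equiv> reachable A a b adj"

text \<open>The positions in the order become the vertices of a graph \<open>G\<close>, so that
  \<open>[0..<N]\<close> replays the game. \<open>l\<close> and \<open>r\<close> place
  \<open>G\<close> in the class with the announced lengths, and \<open>h\<close> bounds its
  chromatic number by \<open>k\<close>; then \<open>online\<close> and \<open>bound\<close>
  apply.\<close>

lemma
  assumes "reach V c" "V \<subseteq> U"
  shows reach_proper: "\<And>u v. u \<in> V \<Longrightarrow> v \<in> V \<Longrightarrow> adj u v \<Longrightarrow> c u \<noteq> c v"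
    and reach_card_le: "card (c ` V) \<le> m"
proof -
  obtain us where us: "distinct us" "set us = V"
      "\<And>i. i < length us \<Longrightarrow> c (us ! i) = play_color A a b adj us i"
    using assms(1) unfolding reachable_def by blast
  define N where "N = length us"
  have mem: "us ! i \<in> U" if "i < N" for i
    using that us(2) assms(2) by (auto simp: N_def)
  have sym: "adj u v \<longleftrightarrow> adj v u" if "u \<in> U" "v \<in> U" for u v
    using that adj_iff by blast
  have neq: "us ! i \<noteq> us ! j" if "i < N" "j < N" "i \<noteq> j" for i j
    using that us(1) by (simp add: N_def nth_eq_iff_index_eq)
  define G :: graph where
    "G = ({..<N}, {{i, j} | i j. i < N \<and> j < N \<and> adj (us ! i) (us ! j)})"
  have edge: "{i, j} \<in> edges G \<longleftrightarrow> adj (us ! i) (us ! j)" if "i < N" "j < N" for i j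
    using that sym mem by (auto simp: G_def doubleton_eq_iff)
  have irr: "\<not> adj (us ! i) (us ! i)" if "i < N" for i
    using that mem adj_iff by blast
  have simple: "simple_graph G"
    unfolding simple_graph_def
  proof (intro conjI ballI)
    fix e assume "e \<in> edges G"
    then obtain i j where ij: "e = {i, j}" "i < N" "j < N" "adj (us ! i) (us ! j)"
      by (auto simp: G_def)
    then have "i \<noteq> j" using irr by auto
    with ij show "e \<subseteq> verts G" "card e = 2" by (auto simp: G_def)
  qed (simp add: G_def)
  have rep: "interval_rep G (\<lambda>i. l (us ! i)) (\<lambda>i. r (us ! i))"
    unfolding interval_rep_def
  proof (intro conjI ballI impI)
    fix v assume "v \<in> verts G"
    then show "l (us ! v) < r (us ! v)"
      using len[of "us ! v"] mem[of v] lengths by (auto simp: G_def)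
  next
    fix u v assume uv: "u \<in> verts G" "v \<in> verts G" "u \<noteq> v"
    then have lt: "u < N" "v < N" by (auto simp: G_def)
    have "l (us ! u) < r (us ! u)" "l (us ! v) < r (us ! v)"
      using len[of "us ! v"] len[of "us ! u"] mem lt lengths by auto
    then have "{l (us ! u)..r (us ! u)} \<inter> {l (us ! v)..r (us ! v)} \<noteq> {} \<longleftrightarrow>
        l (us ! u) \<le> r (us ! v) \<and> l (us ! v) \<le> r (us ! u)"
      by (auto simp: max_def min_def)
    then show "{u, v} \<in> edges G \<longleftrightarrow> {l (us ! u)..r (us ! u)} \<inter> {l (us ! v)..r (us ! v)} \<noteq> {}"
      using edge[OF lt] adj_iff[OF mem mem, OF lt] neq[OF lt uv(3)] by blast
  qed
  have lens: "rep_lengths G (\<lambda>i. l (us ! i)) (\<lambda>i. r (us ! i)) \<subseteq> {a, b}"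
    using len mem unfolding rep_lengths_def G_def by fastforce
  have two: "two_count_interval_graph G"
    unfolding two_count_interval_graph_def
  proof (intro conjI simple exI)
    show "interval_rep G (\<lambda>i. l (us ! i)) (\<lambda>i. r (us ! i))" by (fact rep)
    show "card (rep_lengths G (\<lambda>i. l (us ! i)) (\<lambda>i. r (us ! i))) \<le> 2"
      using card_mono[OF _ lens] lengths by simp
  qed
  have pres: "presentation G a b [0..<N]"
    unfolding presentation_def admissible_lengths_def
  proof (intro conjI exI)
    show "interval_rep G (\<lambda>i. l (us ! i)) (\<lambda>i. r (us ! i))" by (fact rep)
  qed (use lens lengths in \<open>simp_all add: G_def lessThan_atLeast0\<close>)
  have "proper_coloring G (\<lambda>i. h (us ! i))"
    unfolding proper_coloring_def
  proof (intro ballI impI)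
    fix i j assume "i \<in> verts G" "j \<in> verts G" "{i, j} \<in> edges G"
    then show "h (us ! i) \<noteq> h (us ! j)"
      using edge[of i j] mem h_proper by (auto simp: G_def)
  qed
  then have chi: "chromatic_number G \<le> k"
    by (rule chromatic_number_le) (use mem h_less in \<open>auto simp: G_def\<close>)
  have col: "color_at A G a b [0..<N] i = c (us ! i)" if "i < N" for i
  proof -
    have "color_at A G a b [0..<N] i =
        play_color A a b (\<lambda>i j. {i, j} \<in> edges G) [0..<N] i"
      by (simp only: color_at_def history_def play_color_def)
    also have "\<dots> = play_color A a b adj us i"
      using that edge by (intro play_color_cong) simp
    also have "\<dots> = c (us ! i)"
      using that us(3) by (simp add: N_def)
    finally show ?thesis .
  qed
  show "c u \<noteq> c v" if uv: "u \<in> V" "v \<in> V" "adj u v" for u v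
  proof -
    have less: "c (us ! i) \<noteq> c (us ! j)" if "i < j" "j < N" "adj (us ! i) (us ! j)" for i j
    proof -
      have "\<forall>j < length [0..<N]. \<forall>i < j. {[0..<N] ! i, [0..<N] ! j} \<in> edges G \<longrightarrow>
          color_at A G a b [0..<N] i \<noteq> color_at A G a b [0..<N] j"
        using online two pres unfolding online_algorithm_def by blast
      then have "color_at A G a b [0..<N] i \<noteq> color_at A G a b [0..<N] j"
        using that edge[of i j] by auto
      then show ?thesis using col that by simp
    qed
    have "u \<in> set us" "v \<in> set us" using uv us(2) by simp_all
    then obtain i j where ij: "i < N" "j < N" "u = us ! i" "v = us ! j"
      unfolding in_set_conv_nth N_def by blast
    have "i \<noteq> j" using irr uv ij by auto
    then consider "i < j" | "j < i" by linarith
    then show ?thesis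
      using less[of i j] less[of j i] ij uv sym mem by cases metis+
  qed
  have "c ` V = (\<lambda>i. c (us ! i)) ` {..<N}"
    using us(2) unfolding N_def by (auto simp: set_conv_nth)
  also have "\<dots> = color_at A G a b [0..<N] ` {..<length [0..<N]}"
    using col by simp
  finally have "card (c ` V) = colors_used A G a b [0..<N]"
    by (simp add: colors_used_def)
  also have "\<dots> \<le> m"
    using colors_used_le_online_chi[OF simple pres] bound[OF two chi] by (rule order_trans)
  finally show "card (c ` V) \<le> m" .
qed

end

text \<open>Some value is taken at least \<open>card J\<close> times, and \<open>J\<close> is moved
  onto such indices. The result permutes all of \<open>I\<close>, not just injects \<open>J\<close>,
  because it is to induce an automorphism.\<close>

lemma pigeonhole_permutation:
  assumes "finite I" "J \<subseteq> I" "finite F" "f ` I \<subseteq> F" "card F * card J \<le> card I"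
  shows "\<exists>\<sigma> y. bij_betw \<sigma> I I \<and> (\<forall>s \<in> J. f (\<sigma> s) = y)"
proof (cases "J = {}")
  case True
  then show ?thesis using bij_betw_id by blast
next
  case False
  have "\<exists>y \<in> F. card J \<le> card {s \<in> I. f s = y}"
  proof (rule ccontr)
    assume "\<not> ?thesis"
    then have less: "card {s \<in> I. f s = y} < card J" if "y \<in> F" for y
      using that by (meson not_le)
    have "F \<noteq> {}" using False assms(2,4) by auto
    have "I = (\<Union>y \<in> F. {s \<in> I. f s = y})" using assms(4) by auto
    then have "card I \<le> (\<Sum>y \<in> F. card {s \<in> I. f s = y})"
      using card_UN_le[OF assms(3)] by metis
    also have "\<dots> < (\<Sum>y \<in> F. card J)"
      using less \<open>F \<noteq> {}\<close> assms(3) by (intro sum_strict_mono) auto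
    finally show False using assms(5) by simp
  qed
  then obtain y where "card J \<le> card {s \<in> I. f s = y}" by blast
  then obtain S where S: "S \<subseteq> {s \<in> I. f s = y}" "card S = card J" "finite S"
    by (rule obtain_subset_with_card_n)
  have fin: "finite J" using assms(1,2) finite_subset by blast
  obtain h1 where h1: "bij_betw h1 J S"
    using finite_same_card_bij[OF fin S(3)] S(2) by auto
  have SI: "S \<subseteq> I" using S(1) by auto
  have "card (I - J) = card (I - S)"
    using assms(2) SI fin S by (simp add: card_Diff_subset)
  then obtain h2 where h2: "bij_betw h2 (I - J) (I - S)"
    using finite_same_card_bij assms(1) by (metis finite_Diff)
  have "bij_betw (\<lambda>s. if s \<in> J then h1 s else h2 s) (J \<union> (I - J)) (S \<union> (I - S))"
    by (rule bij_betw_disjoint_Un[OF h1 h2]) auto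
  then have "bij_betw (\<lambda>s. if s \<in> J then h1 s else h2 s) I I"
    using assms(2) SI by (simp add: Un_absorb1)
  moreover have "\<forall>s \<in> J. f (if s \<in> J then h1 s else h2 s) = y"
    using h1 S(1) by (auto dest: bij_betwE)
  ultimately show ?thesis
    by (intro exI[of _ "\<lambda>s. if s \<in> J then h1 s else h2 s"] exI[of _ y] conjI)
qed

section \<open>The graph\<close>

text \<open>\<open>Blk g False _\<close> and \<open>Blk g True _\<close> are the left and the right clique of gadget \<open>g\<close>,
  \<open>Mid g _\<close> is the clique between them, and the long intervals \<open>Big g _\<close> cover the whole gadget.\<close>

datatype vertex = Blk nat bool nat | Mid nat nat | Big nat nat

fun gadget_of :: "vertex \<Rightarrow> nat" where
  "gadget_of (Blk g d j) = g"
| "gadget_of (Mid g i) = g"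
| "gadget_of (Big g i) = g"

text \<open>The covers of the gadgets \<open>0, 1, 2, 3\<close> form a path.\<close>

definition near :: "nat \<Rightarrow> nat \<Rightarrow> bool" where
  "near g g' \<longleftrightarrow> g < 4 \<and> g' < 4 \<and> (g' = Suc g \<or> g = Suc g')"

fun vadj :: "vertex \<Rightarrow> vertex \<Rightarrow> bool" where
  "vadj (Blk g d j) (Blk g' d' j') \<longleftrightarrow> g = g' \<and> d = d' \<and> j \<noteq> j'"
| "vadj (Blk g d j) (Mid g' i) \<longleftrightarrow> g = g' \<and> (if d then j \<le> i else i \<le> j)"
| "vadj (Mid g i) (Blk g' d j) \<longleftrightarrow> g = g' \<and> (if d then j \<le> i else i \<le> j)"
| "vadj (Mid g i) (Mid g' i') \<longleftrightarrow> g = g' \<and> i \<noteq> i'"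
| "vadj (Big g i) (Big g' i') \<longleftrightarrow> (g = g' \<and> i \<noteq> i') \<or> near g g'"
| "vadj (Big g i) v \<longleftrightarrow> g = gadget_of v"
| "vadj v (Big g i) \<longleftrightarrow> g = gadget_of v"

text \<open>The gadget index stays unbounded because the number of gadgets grows with
  \<open>m\<close>. Only the clique sizes are limited: \<open>n\<close> inside gadgets,
  \<open>n + 1\<close> for covers.\<close>

fun valid :: "nat \<Rightarrow> vertex \<Rightarrow> bool" where
  "valid n (Blk g d j) \<longleftrightarrow> j < n"
| "valid n (Mid g i) \<longleftrightarrow> i < n"
| "valid n (Big g i) \<longleftrightarrow> i \<le> n"

text \<open>A gadget fits into the interior of a cell of length \<open>6 p\<close>, and its cover is exactly this cell.
  Hence covers in adjacent cells share an endpoint; the cells of the other gadgets are even and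
  at least \<open>8\<close>, so their covers meet no other cover.\<close>

definition cell :: "nat \<Rightarrow> nat" where
  "cell g = (if g < 4 then g else 2 * g)"

text \<open>Relative to the start of the cell, the left block has the intervals from
  \<open>p + j\<close> to \<open>2 * p + j\<close>, the middle those from \<open>2 * p + i\<close>
  to \<open>3 * p + i\<close>, and the right block those from \<open>3 * p + j\<close> to
  \<open>4 * p + j\<close>. Comparing endpoints gives \<open>i \<le> j\<close> on the left and
  \<open>j \<le> i\<close> on the right.\<close>

fun lpos :: "nat \<Rightarrow> vertex \<Rightarrow> nat" where
  "lpos p (Blk g d j) = 6 * (p * cell g) + p + j + (if d then 2 * p else 0)"
| "lpos p (Mid g i) = 6 * (p * cell g) + 2 * p + i"
| "lpos p (Big g i) = 6 * (p * cell g)"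

fun vlen :: "nat \<Rightarrow> vertex \<Rightarrow> nat" where
  "vlen p (Blk g d j) = p"
| "vlen p (Mid g i) = p"
| "vlen p (Big g i) = 6 * p"

text \<open>Left neighbours of \<open>Mid g i\<close> have \<open>j \<ge> i\<close> and get the
  larger color \<open>j + 1\<close>; right ones have \<open>j \<le> i\<close> and get the smaller
  \<open>j - 1\<close>, or \<open>n\<close> if \<open>j = 0\<close>. Gadget and cover use different
  halves of the \<open>2 * (n + 1)\<close> colors, swapped at odd gadgets so that neighbouring
  covers differ.\<close>

fun vcol :: "nat \<Rightarrow> vertex \<Rightarrow> nat" where
  "vcol n (Blk g d j) =
     (if d then if j = 0 then n else j - 1 else Suc j) + (if odd g then Suc n else 0)"
| "vcol n (Mid g i) = i + (if odd g then Suc n else 0)"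
| "vcol n (Big g i) = i + (if odd g then 0 else Suc n)"

section \<open>Correctness of the interval representation and of the coloring\<close>

lemma near_sym: "near g g' \<longleftrightarrow> near g' g"
  by (auto simp: near_def)

lemma near_neq: "\<not> near g g"
  by (simp add: near_def)

lemma vadj_sym: "vadj u v \<longleftrightarrow> vadj v u"
  by (cases u; cases v) (auto simp: near_sym)

text \<open>\<open>u\<close> ends no later than its cell and \<open>v\<close> starts no earlier than
  its own, with equality only for covers. So they can meet only as covers of consecutive
  cells.\<close>

lemma vadj_iff_less:
  assumes "valid n u" "valid n v" "cell (gadget_of u) < cell (gadget_of v)"
  shows "vadj u v \<longleftrightarrow> lpos (Suc n) v \<le> lpos (Suc n) u + vlen (Suc n) u"
    and "lpos (Suc n) u \<le> lpos (Suc n) v + vlen (Suc n) v"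
proof -
  define p where "p = Suc n"
  define c c' where "c = cell (gadget_of u)" and "c' = cell (gadget_of v)"
  have neq: "gadget_of u \<noteq> gadget_of v" using assms(3) by auto
  have near: "near (gadget_of u) (gadget_of v) \<longleftrightarrow> c' = Suc c"
    using assms(3) by (auto simp: near_def c_def c'_def cell_def split: if_splits; presburger)
  have u: "lpos p u + vlen p u \<le> 6 * (p * c) + 6 * p" "6 * (p * c) \<le> lpos p u"
    "\<not> (\<exists>g i. u = Big g i) \<Longrightarrow> lpos p u + vlen p u < 6 * (p * c) + 6 * p"
    using assms(1) by (cases u; simp add: c_def p_def)+
  have v: "6 * (p * c') \<le> lpos p v"
    "\<not> (\<exists>g i. v = Big g i) \<Longrightarrow> 6 * (p * c') < lpos p v"
    by (cases v; simp add: c'_def p_def)+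
  have "p * Suc c \<le> p * c'"
    using assms(3) by (intro mult_le_mono2) (simp add: c_def c'_def)
  then have pc: "p * c + p \<le> p * c'" by simp
  have "lpos p u \<le> lpos p u + vlen p u" by simp
  then show "lpos (Suc n) u \<le> lpos (Suc n) v + vlen (Suc n) v"
    using u(1) v(1) pc unfolding p_def[symmetric] by linarith
  show "vadj u v \<longleftrightarrow> lpos (Suc n) v \<le> lpos (Suc n) u + vlen (Suc n) u"
  proof (cases "(\<exists>g i. u = Big g i) \<and> (\<exists>g i. v = Big g i)")
    case True
    then obtain g i g' i' where uv: "u = Big g i" "v = Big g' i'" by blast
    have "vadj u v \<longleftrightarrow> c' = Suc c" using near neq uv by simp
    also have "\<dots> \<longleftrightarrow> c' \<le> c + 1" using assms(3) by (auto simp: c_def c'_def)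
    also have "\<dots> \<longleftrightarrow> p * c' \<le> p * (c + 1)" unfolding mult_le_cancel1 by (simp add: p_def)
    finally show ?thesis
      unfolding p_def[symmetric] using uv by (auto simp: c_def c'_def)
  next
    case False
    then have "\<not> vadj u v" using neq by (cases u; cases v) auto
    moreover have "lpos p u + vlen p u < lpos p v"
    proof (cases "\<exists>g i. u = Big g i")
      case True
      with False have "6 * (p * c') < lpos p v" using v(2) by blast
      with u(1) pc show ?thesis by linarith
    next
      case False
      from u(3)[OF this] v(1) pc show ?thesis by linarith
    qed
    ultimately show ?thesis by (simp add: p_def)
  qed
qed

lemma vadj_iff_same:
  assumes "valid n u" "valid n v" "gadget_of u = gadget_of v"
  shows "vadj u v \<longleftrightarrow> u \<noteq> v \<and> lpos (Suc n) u \<le> lpos (Suc n) v + vlen (Suc n) v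
    \<and> lpos (Suc n) v \<le> lpos (Suc n) u + vlen (Suc n) u"
  using assms by (cases u; cases v) (auto simp: near_neq)

lemma cell_less_cases:
  obtains "cell g < cell g'" | "g = g'" | "cell g' < cell g"
proof -
  have "cell g < cell g' \<or> g = g' \<or> cell g' < cell g"
    by (auto simp: cell_def)
  then show thesis using that by blast
qed

lemma vadj_iff_intervals:
  assumes "valid n u" "valid n v"
  shows "vadj u v \<longleftrightarrow> u \<noteq> v \<and> lpos (Suc n) u \<le> lpos (Suc n) v + vlen (Suc n) v
    \<and> lpos (Suc n) v \<le> lpos (Suc n) u + vlen (Suc n) u"
  using cell_less_cases[of "gadget_of u" "gadget_of v"]
proof cases
  case 1
  then have "u \<noteq> v" by auto
  with 1 vadj_iff_less[OF assms] show ?thesis by blast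
next
  case 2
  with vadj_iff_same[OF assms] show ?thesis .
next
  case 3
  then have "u \<noteq> v" by auto
  with 3 vadj_iff_less[OF assms(2,1)] vadj_sym show ?thesis by blast
qed

lemma vcol_proper:
  assumes "valid n u" "valid n v" "vadj u v"
  shows "vcol n u \<noteq> vcol n v"
  using assms by (cases u; cases v) (auto simp: near_def split: if_splits)

lemma vcol_less: "valid n v \<Longrightarrow> vcol n v < 2 * Suc n"
  by (cases v) auto
section \<open>The adversary\<close>

context two_length_game
begin

text \<open>A palette is a subset of the at most \<open>m\<close> colors on \<open>V\<close>, so at
  most \<open>2 ^ m\<close> palettes compete in the pigeonhole principle.\<close>

lemma equal_palettes:
  assumes V: "reach V c" "V \<subseteq> U" "finite V"
    and I: "finite I" "J \<subseteq> I" "2 ^ m * card J \<le> card I"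
    and W: "\<And>s. s \<in> I \<Longrightarrow> W s \<subseteq> V"
  obtains \<sigma> P where "bij_betw \<sigma> I I" "\<And>s. s \<in> J \<Longrightarrow> c ` W (\<sigma> s) = P"
proof -
  have "card (Pow (c ` V)) \<le> 2 ^ m"
    using V reach_card_le[OF V(1,2)] by (simp add: card_Pow)
  then have "card (Pow (c ` V)) * card J \<le> 2 ^ m * card J"
    by (rule mult_le_mono1)
  also note I(3)
  finally have card: "card (Pow (c ` V)) * card J \<le> card I" .
  have "finite (Pow (c ` V))" using V(3) by simp
  moreover have "(\<lambda>s. c ` W s) ` I \<subseteq> Pow (c ` V)"
    using W by (auto dest: subsetD)
  ultimately obtain \<sigma> P where "bij_betw \<sigma> I I" "\<forall>s \<in> J. c ` W (\<sigma> s) = P"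
    using pigeonhole_permutation[OF I(1,2) _ _ card] by metis
  then show thesis by (intro that[of \<sigma> P]) auto
qed

end

section \<open>Renaming gadgets\<close>

fun shift :: "(nat \<Rightarrow> nat) \<Rightarrow> vertex \<Rightarrow> vertex" where
  "shift \<sigma> (Blk g d j) = Blk (\<sigma> g) d j"
| "shift \<sigma> (Mid g i) = Mid (\<sigma> g) i"
| "shift \<sigma> (Big g i) = Big (\<sigma> g) i"

lemma gadget_of_shift: "gadget_of (shift \<sigma> v) = \<sigma> (gadget_of v)"
  by (cases v) auto

lemma inj_shift: "inj \<sigma> \<Longrightarrow> inj (shift \<sigma>)"
proof (rule injI)
  fix u v assume "inj \<sigma>" "shift \<sigma> u = shift \<sigma> v"
  then show "u = v" by (cases u; cases v) (auto dest: injD)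
qed

text \<open>The relation \<open>near\<close> between covers is the only part of \<open>vadj\<close>
  that depends on more than equality of gadget numbers.\<close>

lemma vadj_shift:
  assumes "inj \<sigma>"
    and "\<And>g i g' i'. u = Big g i \<Longrightarrow> v = Big g' i' \<Longrightarrow> \<not> near g g' \<and> \<not> near (\<sigma> g) (\<sigma> g')"
  shows "vadj (shift \<sigma> u) (shift \<sigma> v) \<longleftrightarrow> vadj u v"
  using assms by (cases u; cases v) (auto simp: gadget_of_shift inj_eq)

lemma bij_betw_if_inj:
  assumes "bij_betw \<sigma> I I"
  shows "inj (\<lambda>g. if g \<in> I then \<sigma> g else g)"
  using assms by (auto simp: inj_on_def bij_betw_def)

definition gadget :: "nat \<Rightarrow> nat \<Rightarrow> vertex set" where
  "gadget n g = {Blk g d j | d j. j < n} \<union> {Mid g i | i. i < n}"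

definition cover :: "nat \<Rightarrow> nat \<Rightarrow> vertex set" where
  "cover n g = {Big g i | i. i \<le> n}"

text \<open>Blocks and middles are collected over many gadgets because each kind is presented in a
  stage of its own.\<close>

definition blocks :: "nat \<Rightarrow> nat \<Rightarrow> vertex set" where
  "blocks n M = {Blk g d j | g d j. g < M \<and> j < n}"

definition mids :: "nat \<Rightarrow> nat \<Rightarrow> vertex set" where
  "mids n N = {Mid g i | g i. g < N \<and> i < n}"

lemma finite_blocks [simp]: "finite (blocks n M)"
proof -
  have "blocks n M = (\<lambda>(g, d, j). Blk g d j) ` ({..<M} \<times> UNIV \<times> {..<n})"
    by (force simp: blocks_def)
  then show ?thesis by simp
qed

lemma finite_mids [simp]: "finite (mids n N)"
proof -
  have "mids n N = (\<lambda>(g, i). Mid g i) ` ({..<N} \<times> {..<n})"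
    by (force simp: mids_def)
  then show ?thesis by simp
qed

lemma cover_eq: "cover n g = Big g ` {..n}"
  by (auto simp: cover_def)

lemma finite_cover [simp]: "finite (cover n g)"
  by (simp add: cover_eq)

lemma shift_gadget: "shift \<sigma> ` gadget n g = gadget n (\<sigma> g)"
  by (force simp: gadget_def image_iff)

lemma shift_cover: "shift \<sigma> ` cover n g = cover n (\<sigma> g)"
  by (force simp: cover_def image_iff)

section \<open>The stages of the adversary\<close>

locale gadget_game = two_length_game A a b vadj "{v. valid n v}" l r h k m
  for A a b l r h k m n
begin

lemma reach_shift:
  assumes c: "reach V c" "finite V" and \<sigma>: "inj \<sigma>" "shift \<sigma> ` V \<subseteq> V"
    and far: "\<And>g i g' i'. Big g i \<in> V \<Longrightarrow> Big g' i' \<in> V \<Longrightarrow> \<not> near g g'"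
  shows "reach V (c \<circ> shift \<sigma>)"
proof (rule reachable_automorphism[OF c(1)])
  have "inj_on (shift \<sigma>) V"
    using inj_shift[OF \<sigma>(1)] inj_on_subset by blast
  moreover from this have "shift \<sigma> ` V = V"
    using c(2) \<sigma>(2) endo_inj_surj by blast
  ultimately show "bij_betw (shift \<sigma>) V V"
    by (simp add: bij_betw_def)
next
  fix u v assume uv: "u \<in> V" "v \<in> V"
  then have "shift \<sigma> u \<in> V" "shift \<sigma> v \<in> V" using \<sigma>(2) by auto
  with uv show "vadj (shift \<sigma> u) (shift \<sigma> v) \<longleftrightarrow> vadj u v"
    using far by (intro vadj_shift[OF \<sigma>(1)]) auto
qed

text \<open>Blocks alone are disjoint cliques of equal size. Pigeonholing moves \<open>2 * N\<close>
  of them with one palette to the gadgets below \<open>N\<close>; permuting inside each clique then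
  aligns the colors index by index.\<close>

lemma uniform_blocks:
  assumes "0 < N"
  obtains c x where "reach (blocks n (2 ^ m * N)) c" "inj_on x {..<n}"
    "\<forall>g < N. \<forall>d. \<forall>j < n. c (Blk g d j) = x j"
proof -
  define V where "V = blocks n (2 ^ m * N)"
  define I where "I = {..<2 ^ m * N} \<times> (UNIV :: bool set)"
  define J where "J = {..<N} \<times> (UNIV :: bool set)"
  define blk where "blk s j = Blk (fst s) (snd s) j" for s j
  have fin: "finite V" by (simp add: V_def)
  have valid: "V \<subseteq> {v. valid n v}" by (auto simp: V_def blocks_def)
  obtain c where c: "reach V c"
    by (rule reachable_extend[OF reachable_empty[of A a b vadj] fin]) auto
  have blk_V: "blk s j \<in> V" if "s \<in> I" "j < n" for s j
    using that by (auto simp: V_def blocks_def blk_def I_def)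
  have I: "finite I" "card I = 2 ^ m * N * 2" by (simp_all add: I_def card_UNIV_bool)
  have J: "J \<subseteq> I" "card J = N * 2"
    using le_trans[of N "1 * N" "2 ^ m * N"]
    by (auto simp: I_def J_def card_UNIV_bool intro: order.strict_trans2)
  obtain \<sigma> P where \<sigma>: "bij_betw \<sigma> I I" and P: "\<And>s. s \<in> J \<Longrightarrow> c ` blk (\<sigma> s) ` {..<n} = P"
    by (rule equal_palettes[OF c valid fin I(1) J(1), of "\<lambda>s. blk s ` {..<n}"])
      (use I J blk_V in auto)
  have \<sigma>I: "\<sigma> s \<in> I" if "s \<in> I" for s
    using \<sigma> that by (auto dest: bij_betwE)
  define e where "e s j = c (blk (\<sigma> s) j)" for s j
  have e: "bij_betw (e s) {..<n} P" if s: "s \<in> J" for s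
    unfolding bij_betw_def
  proof
    show "inj_on (e s) {..<n}"
    proof (rule inj_onI, rule ccontr)
      fix i j assume ij: "i \<in> {..<n}" "j \<in> {..<n}" "e s i = e s j" "i \<noteq> j"
      have "\<sigma> s \<in> I" using s J(1) \<sigma>I by blast
      then have "blk (\<sigma> s) i \<in> V" "blk (\<sigma> s) j \<in> V"
        using ij by (simp_all add: blk_V)
      then have "c (blk (\<sigma> s) i) \<noteq> c (blk (\<sigma> s) j)"
        by (rule reach_proper[OF c valid]) (use ij in \<open>simp add: blk_def\<close>)
      with ij(3) show False by (simp add: e_def)
    qed
    show "e s ` {..<n} = P"
      using P[OF s] by (auto simp: e_def)
  qed
  \<comment> \<open>One block of \<open>J\<close> serves as the reference enumeration of
    \<open>P\<close>; it exists because \<open>0 < N\<close>.\<close>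
  define x where "x = e (0, False)"
  have x: "bij_betw x {..<n} P"
    using e assms by (simp add: x_def J_def)
  \<comment> \<open>Chosen so that \<open>e s (\<pi> s j) = x j\<close> for
    \<open>s \<in> J\<close>; the other blocks are not rearranged inside.\<close>
  define \<pi> where "\<pi> s = (if s \<in> J then inv_into {..<n} (e s) \<circ> x else id)" for s
  have \<pi>: "bij_betw (\<pi> s) {..<n} {..<n}" for s
    using bij_betw_trans[OF x bij_betw_inv_into[OF e]] by (simp add: \<pi>_def)
  define \<phi> where "\<phi> v = (case v of Blk g d j \<Rightarrow> blk (\<sigma> (g, d)) (\<pi> (g, d) j) | _ \<Rightarrow> v)" for v
  have \<phi>_blk: "\<phi> (blk s j) = blk (\<sigma> s) (\<pi> s j)" for s j
    by (simp add: \<phi>_def blk_def)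
  have V_cases: "\<exists>s j. v = blk s j \<and> s \<in> I \<and> j < n" if "v \<in> V" for v
    using that by (auto simp: V_def blocks_def blk_def I_def)
  have \<pi>_less: "\<pi> s j < n" if "j < n" for s j
    using bij_betwE[OF \<pi>] that by blast
  have blk_eq: "blk s j = blk s' j' \<longleftrightarrow> s = s' \<and> j = j'" for s j s' j'
    by (auto simp: blk_def prod_eq_iff)
  have \<sigma>_eq: "\<sigma> s = \<sigma> s' \<longleftrightarrow> s = s'" if "s \<in> I" "s' \<in> I" for s s'
    using \<sigma> that by (auto simp: bij_betw_def inj_on_eq_iff)
  have \<pi>_eq: "\<pi> s j = \<pi> s j' \<longleftrightarrow> j = j'" if "j < n" "j' < n" for s j j'
    using \<pi>[of s] that by (auto simp: bij_betw_def inj_on_eq_iff)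
  have "inj_on \<phi> V"
    by (rule inj_onI) (auto dest!: V_cases simp: \<phi>_blk blk_eq \<sigma>_eq \<pi>_eq)
  moreover have "\<phi> ` V \<subseteq> V"
    by (auto dest!: V_cases simp: \<phi>_blk intro!: blk_V \<sigma>I \<pi>_less)
  ultimately have "bij_betw \<phi> V V"
    using fin by (simp add: bij_betw_def endo_inj_surj)
  moreover have "vadj (\<phi> u) (\<phi> v) \<longleftrightarrow> vadj u v" if uv: "u \<in> V" "v \<in> V" for u v
  proof -
    have vadj_blk: "vadj (blk s j) (blk s' j') \<longleftrightarrow> s = s' \<and> j \<noteq> j'" for s j s' j'
      by (auto simp: blk_def prod_eq_iff)
    obtain s j s' j' where "u = blk s j" "s \<in> I" "j < n" "v = blk s' j'" "s' \<in> I" "j' < n"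
      using V_cases uv by metis
    then show ?thesis by (auto simp: \<phi>_blk vadj_blk \<sigma>_eq \<pi>_eq)
  qed
  ultimately have "reach V (c \<circ> \<phi>)"
    by (rule reachable_automorphism[OF c])
  moreover have "(c \<circ> \<phi>) (Blk g d j) = x j" if "g < N" "j < n" for g d j
  proof -
    have s: "(g, d) \<in> J" using that by (simp add: J_def)
    have "(c \<circ> \<phi>) (Blk g d j) = e (g, d) (\<pi> (g, d) j)"
      by (simp add: \<phi>_def e_def)
    also have "\<dots> = x j"
      using s that e[OF s] bij_betwE[OF x] by (simp add: \<pi>_def bij_betw_inv_into_right)
    finally show ?thesis .
  qed
  moreover have "inj_on x {..<n}" using x by (rule bij_betw_imp_inj_on)
  ultimately show thesis
    unfolding V_def by (intro that[of "c \<circ> \<phi>" x]) blast+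
qed

text \<open>Each middle vertex sees all colors \<open>x j\<close>, so every middle clique brings
  \<open>n\<close> new colors. Pigeonholing over \<open>2 ^ m * K\<close> middles makes these agree
  on \<open>K\<close> gadgets.\<close>

lemma uniform_gadgets:
  assumes "0 < K"
  obtains c C where "reach (blocks n (2 ^ m * (2 ^ m * K)) \<union> mids n (2 ^ m * K)) c"
    "card C = 2 * n" "\<forall>g < K. c ` gadget n g = C"
proof -
  define N where "N = 2 ^ m * K"
  define M where "M = 2 ^ m * N"
  define V where "V = blocks n M \<union> mids n N"
  have le: "K \<le> N" "N \<le> M" by (simp_all add: N_def M_def)
  have fin: "finite V" by (simp add: V_def)
  have valid: "V \<subseteq> {v. valid n v}" by (auto simp: V_def blocks_def mids_def)
  have "0 < N" using assms le by simp
  from uniform_blocks[OF this, folded M_def]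
  obtain c\<^sub>0 x where c\<^sub>0: "reach (blocks n M) c\<^sub>0" "inj_on x {..<n}"
      "\<forall>g < N. \<forall>d. \<forall>j < n. c\<^sub>0 (Blk g d j) = x j" .
  have disj: "blocks n M \<inter> mids n N = {}" by (auto simp: blocks_def mids_def)
  obtain c where c: "reach V c" "\<And>v. v \<in> blocks n M \<Longrightarrow> c v = c\<^sub>0 v"
    unfolding V_def by (rule reachable_extend[OF c\<^sub>0(1) finite_mids disj]) blast
  have blk_V: "Blk g d j \<in> V" if "g < M" "j < n" for g d j
    using that by (auto simp: V_def blocks_def)
  have mid_V: "Mid g i \<in> V" if "g < N" "i < n" for g i
    using that by (auto simp: V_def mids_def)
  have cx: "c (Blk g d j) = x j" if "g < N" "j < n" for g d j
    using that c c\<^sub>0(3) le by (auto simp: blocks_def)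
  obtain \<sigma> P where \<sigma>: "bij_betw \<sigma> {..<N} {..<N}"
      and P: "\<And>g. g \<in> {..<K} \<Longrightarrow> c ` Mid (\<sigma> g) ` {..<n} = P"
    by (rule equal_palettes[OF c(1) valid fin, of "{..<N}" "{..<K}" "\<lambda>g. Mid g ` {..<n}"])
      (use le mid_V in \<open>auto simp: N_def\<close>)
  have \<sigma>N: "\<sigma> g < N" if "g < N" for g
    using bij_betwE[OF \<sigma>] that by blast
  \<comment> \<open>Gadgets from \<open>N\<close> on have blocks but no middles and stay fixed.
    Below \<open>N\<close> all blocks are colored by \<open>x\<close>, so the renaming does not
    disturb them.\<close>
  define \<tau> where "\<tau> g = (if g \<in> {..<N} then \<sigma> g else g)" for g
  have \<tau>M: "\<tau> g < M" if "g < M" for g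
    using \<sigma>N[of g] le that by (auto simp: \<tau>_def)
  have \<tau>N: "\<tau> g < N" if "g < N" for g
    using \<sigma>N[of g] that by (auto simp: \<tau>_def)
  have reach: "reach V (c \<circ> shift \<tau>)"
  proof (rule reach_shift[OF c(1) fin])
    show "inj \<tau>" unfolding \<tau>_def by (rule bij_betw_if_inj[OF \<sigma>])
    show "shift \<tau> ` V \<subseteq> V"
      using \<tau>M \<tau>N by (auto simp: V_def blocks_def mids_def)
  qed (auto simp: V_def blocks_def mids_def)
  have Mid_Blk: "c (Mid g i) \<noteq> x j" if "g < N" "i < n" "j < n" for g i j
  proof -
    \<comment> \<open>The flag \<open>j \<le> i\<close> selects a side on which the two vertices are
      adjacent: right if \<open>j \<le> i\<close>, left if \<open>i < j\<close>.\<close>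
    have "c (Mid g i) \<noteq> c (Blk g (j \<le> i) j)"
      by (rule reach_proper[OF c(1) valid]) (use that le in \<open>auto intro!: blk_V mid_V\<close>)
    with cx[OF that(1,3)] show ?thesis by simp
  qed
  have inj_Mid: "inj_on (\<lambda>i. c (Mid g i)) {..<n}" if "g < N" for g
  proof (rule inj_onI, rule ccontr)
    fix i j assume ij: "i \<in> {..<n}" "j \<in> {..<n}" "c (Mid g i) = c (Mid g j)" "i \<noteq> j"
    have "c (Mid g i) \<noteq> c (Mid g j)"
      by (rule reach_proper[OF c(1) valid]) (use ij that in \<open>auto intro!: mid_V\<close>)
    with ij(3) show False by simp
  qed
  define C where "C = x ` {..<n} \<union> P"
  have C: "(c \<circ> shift \<tau>) ` gadget n g = C" if "g < K" for g
  proof -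
    have g: "g < N" using that le by simp
    have "gadget n g = (\<Union>d. Blk g d ` {..<n}) \<union> Mid g ` {..<n}"
      by (auto simp: gadget_def)
    then have "(c \<circ> shift \<tau>) ` gadget n g =
        (\<Union>d. (\<lambda>j. c (Blk (\<sigma> g) d j)) ` {..<n}) \<union> c ` Mid (\<sigma> g) ` {..<n}"
      using g by (simp add: image_Un image_UN image_image \<tau>_def)
    also have "(\<Union>d. (\<lambda>j. c (Blk (\<sigma> g) d j)) ` {..<n}) = x ` {..<n}"
      using cx[OF \<sigma>N[OF g]] by auto
    also have "c ` Mid (\<sigma> g) ` {..<n} = P" using P that by simp
    finally show ?thesis by (simp add: C_def)
  qed
  have \<sigma>0: "\<sigma> 0 < N" using \<sigma>N \<open>0 < N\<close> by simp
  have P0: "P = (\<lambda>i. c (Mid (\<sigma> 0) i)) ` {..<n}"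
    using P[of 0] assms by (simp add: image_image)
  have "card P = n"
    unfolding P0 using card_image[OF inj_Mid[OF \<sigma>0]] by simp
  moreover have "x ` {..<n} \<inter> P = {}"
    unfolding P0 using Mid_Blk[OF \<sigma>0] by fastforce
  moreover have "finite P" by (simp add: P0)
  ultimately have "card C = 2 * n"
    unfolding C_def using card_image[OF c\<^sub>0(2)] by (simp add: card_Un_disjoint)
  with reach C show thesis
    unfolding V_def M_def N_def by (intro that[of "c \<circ> shift \<tau>" C]) blast+
qed

text \<open>The count is \<open>2 * n\<close> colors for the gadgets, \<open>n + 1\<close> for both
  end covers together, and \<open>n + 1\<close> for each of the two inner covers.\<close>

lemma forced_colors: "5 * n + 3 \<le> m"
proof -
  define K :: nat where "K = 2 ^ m * 2 + 4"
  define V where "V = blocks n (2 ^ m * (2 ^ m * K)) \<union> mids n (2 ^ m * K)"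
  \<comment> \<open>The inner covers are withheld at first. Without them no two covers are near, so
    gadgets can still be renamed, and \<open>I\<close> keeps enough indices to find two equal
    palettes for \<open>0\<close> and \<open>3\<close>.\<close>
  define I where "I = {..<K} - {1, 2}"
  define V' where "V' = V \<union> (\<Union>g \<in> I. cover n g)"
  define V'' where "V'' = V' \<union> (cover n 1 \<union> cover n 2)"
  have "0 < K" by (simp add: K_def)
  from uniform_gadgets[OF this, folded V_def]
  obtain c\<^sub>0 C where c\<^sub>0: "reach V c\<^sub>0"
    and C: "card C = 2 * n" "\<forall>g < K. c\<^sub>0 ` gadget n g = C" .
  have I: "finite I" "{0, 3} \<subseteq> I" "card I = 2 ^ m * 2 + 2"
    by (auto simp: I_def K_def card_Diff_subset)
  have K_le: "K \<le> 2 ^ m * K" "K \<le> 2 ^ m * (2 ^ m * K)"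
    using le_trans[of K "2 ^ m * K" "2 ^ m * (2 ^ m * K)"] by simp_all
  have gadget_V: "gadget n g \<subseteq> V" if "g < K" for g
    using less_le_trans[OF that K_le(1)] less_le_trans[OF that K_le(2)]
    by (auto simp: gadget_def V_def blocks_def mids_def)
  have fin: "finite V" "finite V'" "finite V''"
    using I by (simp_all add: V_def V'_def V''_def)
  have valid: "V' \<subseteq> {v. valid n v}" "V'' \<subseteq> {v. valid n v}"
    by (auto simp: V_def V'_def V''_def blocks_def mids_def cover_def)
  have Big_V': "g \<in> I" if "Big g i \<in> V'" for g i
    using that by (auto simp: V'_def V_def blocks_def mids_def cover_def)
  have disj\<^sub>1: "V \<inter> (\<Union>g \<in> I. cover n g) = {}" and fin\<^sub>1: "finite (\<Union>g \<in> I. cover n g)"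
    using I by (auto simp: V_def blocks_def mids_def cover_def)
  obtain c\<^sub>1 where c\<^sub>1: "reach V' c\<^sub>1" "\<And>v. v \<in> V \<Longrightarrow> c\<^sub>1 v = c\<^sub>0 v"
    unfolding V'_def by (rule reachable_extend[OF c\<^sub>0 fin\<^sub>1 disj\<^sub>1]) blast
  have C1: "c\<^sub>1 ` gadget n g = C" if "g < K" for g
  proof -
    have "c\<^sub>1 ` gadget n g = c\<^sub>0 ` gadget n g"
      using gadget_V[OF that] c\<^sub>1(2) by (intro image_cong) auto
    then show ?thesis using C(2) that by simp
  qed
  obtain \<sigma> P where \<sigma>: "bij_betw \<sigma> I I" and P: "\<And>g. g \<in> {0, 3} \<Longrightarrow> c\<^sub>1 ` cover n (\<sigma> g) = P"
    by (rule equal_palettes[OF c\<^sub>1(1) valid(1) fin(2) I(1,2), of "cover n"])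
      (use I in \<open>auto simp: V'_def\<close>)
  define \<tau> where "\<tau> g = (if g \<in> I then \<sigma> g else g)" for g
  have \<tau>I: "\<tau> g \<in> I" if "g \<in> I" for g
    using bij_betwE[OF \<sigma>] that by (simp add: \<tau>_def)
  have \<tau>less: "\<tau> g < L" if "g < L" "K \<le> L" for g L
    using \<tau>I[of g] that by (cases "g \<in> I") (auto simp: I_def \<tau>_def)
  have c\<^sub>1\<tau>: "reach V' (c\<^sub>1 \<circ> shift \<tau>)"
  proof (rule reach_shift[OF c\<^sub>1(1) fin(2)])
    show "inj \<tau>" unfolding \<tau>_def by (rule bij_betw_if_inj[OF \<sigma>])
    have "shift \<tau> ` V \<subseteq> V"
      unfolding V_def blocks_def mids_def using \<tau>less[OF _ K_le(1)] \<tau>less[OF _ K_le(2)] by auto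
    moreover have "shift \<tau> ` (\<Union>g \<in> I. cover n g) \<subseteq> (\<Union>g \<in> I. cover n g)"
      unfolding image_UN shift_cover by (intro UN_least UN_upper \<tau>I)
    ultimately show "shift \<tau> ` V' \<subseteq> V'"
      unfolding V'_def image_Un by (rule Un_mono)
    show "\<not> near g g'" if "Big g i \<in> V'" "Big g' i' \<in> V'" for g i g' i'
      using Big_V'[OF that(1)] Big_V'[OF that(2)] by (auto simp: I_def near_def)
  qed
  have disj\<^sub>2: "V' \<inter> (cover n 1 \<union> cover n 2) = {}"
    using Big_V' by (auto simp: cover_def I_def)
  have fin\<^sub>2: "finite (cover n 1 \<union> cover n 2)" by simp
  obtain c where c: "reach V'' c" "\<And>v. v \<in> V' \<Longrightarrow> c v = (c\<^sub>1 \<circ> shift \<tau>) v"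
    unfolding V''_def by (rule reachable_extend[OF c\<^sub>1\<tau> fin\<^sub>2 disj\<^sub>2]) blast
  have proper: "c u \<noteq> c v" if "u \<in> V''" "v \<in> V''" "vadj u v" for u v
    using reach_proper[OF c(1) valid(2)] that by blast
  have gadget_V'': "gadget n g \<subseteq> V'" "gadget n g \<subseteq> V''" if "g < K" for g
    using gadget_V[OF that] by (auto simp: V'_def V''_def)
  have cover_V'': "cover n g \<subseteq> V''" if "g < 4" for g
  proof -
    have "g \<in> I \<or> g = 1 \<or> g = 2" using that by (auto simp: I_def K_def)
    then show ?thesis by (auto simp: V'_def V''_def)
  qed
  have K4: "g < K" if "g < 4" for g using that by (simp add: K_def)
  have c_gadget: "c ` gadget n g = C" if "g < 4" for g
  proof -
    have "c ` gadget n g = c\<^sub>1 ` shift \<tau> ` gadget n g"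
      unfolding image_image using gadget_V''(1)[OF K4[OF that]] c(2) by (intro image_cong) auto
    \<comment> \<open>All gadgets below \<open>K\<close> share the palette \<open>C\<close>, so
      moving them along \<open>\<tau>\<close> is harmless.\<close>
    also have "\<dots> = C"
      using C1[OF \<tau>less[OF K4[OF that] order_refl]] by (simp add: shift_gadget)
    finally show ?thesis .
  qed
  have c_cover: "c ` cover n g = P" if "g \<in> {0, 3}" for g
  proof -
    have g: "g \<in> I" using that I(2) by blast
    then have "c ` cover n g = c\<^sub>1 ` shift \<tau> ` cover n g"
      unfolding image_image using c(2) by (intro image_cong) (auto simp: V'_def)
    also have "\<dots> = P"
      using P[OF that] g by (simp add: shift_cover \<tau>_def)
    finally show ?thesis .
  qed
  have card_cover: "card (c ` cover n g) = Suc n" if "g < 4" for g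
  proof -
    have "inj_on c (cover n g)"
    proof (rule inj_onI, rule ccontr)
      fix u v assume uv: "u \<in> cover n g" "v \<in> cover n g" "c u = c v" "u \<noteq> v"
      then have "vadj u v" by (auto simp: cover_def)
      with proper[of u v] uv cover_V''[OF that] show False by blast
    qed
    then show ?thesis
      by (simp add: card_image cover_eq inj_on_def)
  qed
  have C_cover: "C \<inter> c ` cover n g = {}" if "g < 4" for g
  proof -
    have "c u \<noteq> c v" if uv: "u \<in> gadget n g" "v \<in> cover n g" for u v
    proof (rule proper)
      show "u \<in> V''" "v \<in> V''"
        using uv gadget_V''(2)[OF K4] cover_V'' \<open>g < 4\<close> by blast+
      show "vadj u v" using uv by (auto simp: gadget_def cover_def)
    qed
    then show ?thesis
      unfolding c_gadget[OF that, symmetric] by blast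
  qed
  have cover_cover: "c ` cover n g \<inter> c ` cover n (Suc g) = {}" if "g < 3" for g
  proof -
    have "c u \<noteq> c v" if uv: "u \<in> cover n g" "v \<in> cover n (Suc g)" for u v
    proof (rule proper)
      show "u \<in> V''" "v \<in> V''"
        using uv cover_V''[of g] cover_V''[of "Suc g"] \<open>g < 3\<close> by auto
      show "vadj u v" using uv \<open>g < 3\<close> by (auto simp: cover_def near_def)
    qed
    then show ?thesis by blast
  qed
  let ?Z = "c ` cover n 1" and ?W = "c ` cover n 2"
  have P: "P = c ` cover n 0" "P = c ` cover n 3" using c_cover by auto
  \<comment> \<open>\<open>P\<close> occurs at both ends of the path: cover \<open>1\<close> avoids
    it because of cover \<open>0\<close>, cover \<open>2\<close> because of cover
    \<open>3\<close>.\<close>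
  have disj: "P \<inter> ?Z = {}" "P \<inter> ?W = {}" "?Z \<inter> ?W = {}" "C \<inter> P = {}" "C \<inter> ?Z = {}" "C \<inter> ?W = {}"
    using cover_cover[of 0] cover_cover[of 1] cover_cover[of 2] C_cover[of 0] C_cover[of 1]
      C_cover[of 2] P by (simp_all add: eval_nat_numeral Int_commute)
  have card: "card P = Suc n" "card ?Z = Suc n" "card ?W = Suc n"
    using card_cover P(1) by simp_all
  have finC: "finite C" "finite P"
    using c_gadget[of 0] finite_subset[OF gadget_V''(1)[OF K4[of 0]] fin(2)] P(1) by auto
  have "C \<union> (P \<union> (?Z \<union> ?W)) \<subseteq> c ` V''"
    unfolding P(1) c_gadget[of 0, symmetric, simplified]
    using gadget_V''(2)[OF K4[of 0]] cover_V''[of 0] cover_V''[of 1] cover_V''[of 2]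
    by (intro Un_least image_mono) simp_all
  then have "card (C \<union> (P \<union> (?Z \<union> ?W))) \<le> card (c ` V'')"
    using fin(3) by (intro card_mono) auto
  also have "\<dots> \<le> m"
    by (rule reach_card_le[OF c(1) valid(2)])
  also have "card (C \<union> (P \<union> (?Z \<union> ?W))) = card C + (card P + (card ?Z + card ?W))"
    using disj finC by (simp add: card_Un_disjoint Int_Un_distrib)
  finally show ?thesis
    using card C(1) by simp
qed

end

section \<open>From forced colors to the competitive ratio\<close>

lemma gadget_game_lengths:
  assumes "online_algorithm A"
    and "\<And>G. two_count_interval_graph G \<Longrightarrow> chromatic_number G \<le> 2 * Suc n \<Longrightarrow> online_chi A G \<le> m"
  shows "gadget_game A (real (Suc n)) (real (6 * Suc n)) (\<lambda>v. real (lpos (Suc n) v))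
    (\<lambda>v. real (lpos (Suc n) v + vlen (Suc n) v)) (vcol n) (2 * Suc n) m n"
proof
  fix v assume "v \<in> {v. valid n v}"
  then show "real (lpos (Suc n) v + vlen (Suc n) v) - real (lpos (Suc n) v)
      \<in> {real (Suc n), real (6 * Suc n)}"
    by (cases v) auto
  show "vcol n v < 2 * Suc n"
    using \<open>v \<in> _\<close> vcol_less by blast
next
  fix u v assume "u \<in> {v. valid n v}" "v \<in> {v. valid n v}"
  then show "vadj u v \<longleftrightarrow> u \<noteq> v \<and>
      real (lpos (Suc n) u) \<le> real (lpos (Suc n) v + vlen (Suc n) v) \<and>
      real (lpos (Suc n) v) \<le> real (lpos (Suc n) u + vlen (Suc n) u)"
    unfolding of_nat_le_iff using vadj_iff_intervals by blast
qed (use assms vcol_proper in auto)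

text \<open>At least \<open>5 * n + 3\<close> colors are forced at chromatic number at most
  \<open>2 * n + 2\<close>; comparing the growth in \<open>n\<close> gives the ratio.\<close>

lemma competitive_ge:
  assumes "online_algorithm A" "competitive \<rho> A"
  shows "5 / 2 \<le> \<rho>"
proof (rule ccontr)
  assume "\<not> 5 / 2 \<le> \<rho>"
  \<comment> \<open>Only an upper bound on the chromatic number is known, so the factor must be
    nonnegative for monotonicity.\<close>
  define \<rho>' where "\<rho>' = max \<rho> 0"
  have \<rho>': "\<rho> \<le> \<rho>'" "0 \<le> \<rho>'" "\<rho>' < 5 / 2"
    using \<open>\<not> 5 / 2 \<le> \<rho>\<close> by (auto simp: \<rho>'_def)
  obtain b where b: "\<And>G. two_count_interval_graph G \<Longrightarrow>
      real (online_chi A G) \<le> \<rho> * real (chromatic_number G) + b"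
    using assms(2) unfolding competitive_def by blast
  have forced: "5 * real n + 3 \<le> \<rho>' * (2 * (real n + 1)) + \<bar>b\<bar>" for n
  proof -
    define B where "B = \<rho>' * (2 * (real n + 1)) + \<bar>b\<bar>"
    have "0 \<le> B" using \<rho>'(2) by (simp add: B_def)
    have "online_chi A G \<le> nat \<lfloor>B\<rfloor>"
      if G: "two_count_interval_graph G" "chromatic_number G \<le> 2 * Suc n" for G
    proof -
      have "real (chromatic_number G) \<le> real (2 * Suc n)"
        using G(2) by (simp only: of_nat_le_iff)
      then have "\<rho>' * real (chromatic_number G) \<le> \<rho>' * (2 * (real n + 1))"
        using \<rho>'(2) by (intro mult_left_mono) auto
      moreover have "\<rho> * real (chromatic_number G) \<le> \<rho>' * real (chromatic_number G)"
        using \<rho>'(1) by (rule mult_right_mono) simp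
      ultimately have "real (online_chi A G) \<le> B"
        using b[OF G(1)] unfolding B_def by linarith
      then show ?thesis by (simp add: le_nat_floor)
    qed
    then have "5 * n + 3 \<le> nat \<lfloor>B\<rfloor>"
      by (rule gadget_game.forced_colors[OF gadget_game_lengths[OF assms(1)]])
    then have "real (5 * n + 3) \<le> B"
      using \<open>0 \<le> B\<close> by linarith
    then show ?thesis by (simp add: B_def)
  qed
  \<comment> \<open>The factor \<open>5 - 2 * \<rho>'\<close> is positive, so the left side is
    unbounded in \<open>n\<close>.\<close>
  have bounded: "real n * (5 - 2 * \<rho>') \<le> 2 * \<rho>' + \<bar>b\<bar>" for n
    using forced[of n] by (simp add: algebra_simps)
  obtain n :: nat where "2 * \<rho>' + \<bar>b\<bar> < real n * (5 - 2 * \<rho>')"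
    using ex_less_of_nat_mult[of "5 - 2 * \<rho>'"] \<rho>'(3) by auto
  with bounded[of n] show False by simp
qed

theorem theorem17:
  shows "two_plus \<ge> 5 / 2 \<and> \<not> (\<exists>A. online_algorithm A \<and> competitive_ratio A < 5 / 2)"
proof -
  have ereal: "(5 / 2 :: ereal) = ereal (5 / 2)"
    by (metis ereal_divide numeral_eq_ereal numeral_neq_zero)
  have ratio: "5 / 2 \<le> competitive_ratio A" if "online_algorithm A" for A
    unfolding competitive_ratio_def ereal
    using competitive_ge[OF that] by (intro INF_greatest) simp
  then have "5 / 2 \<le> two_plus"
    unfolding two_plus_def by (intro INF_greatest) simp
  with ratio show ?thesis by (auto simp: not_less)
qed

end
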